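(* Let $n,q$ be coprime integers with $0<q<n$ and $q\neq n-1$, and let $f=x^{n-q}y-z^n\in\mathbb C[x,y,z]$. For each $1\le k\le n-1$ put $$A_k=\begin{pmatrix} y & -z^k\\ -z^{n-k} & x^{n-q}\end{pmatrix},\qquad B_k=\begin{pmatrix} x^{n-q} & z^k\\ z^{n-k} & y\end{pmatrix}.$$ Then for every $1\le k\le n-1$ the pair $(A_k,B_k)$ is a $2\times2$ matrix factorization of $f$.
   Context: A ($k\times k$) matrix factorization of $f\in S=\mathbb C[x,y,z]$ is a pair $(\varphi,\psi)$ of $k\times k$ matrices over $S$ with $\varphi\psi=\psi\varphi=f\,\mathrm{Id}_k$. *)

theory Defs
  imports Complex_Main "HOL-Library.Poly_Mapping" "Jordan_Normal_Form.Matrix"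
begin

text \<open>
  The polynomial ring \<open>S = \<complex>[x,y,z]\<close> is the monoid algebra over the complex numbers of the free
  commutative monoid on three generators: a monomial is an exponent vector \<open>var \<Rightarrow>\<^sub>0 nat\<close>, and a
  polynomial is a finitely supported family of coefficients indexed by monomials.
\<close>

datatype var = VX | VY | VZ

type_synonym S = "(var \<Rightarrow>\<^sub>0 nat) \<Rightarrow>\<^sub>0 complex"

definition Var :: "var \<Rightarrow> S" where
  "Var v = Poly_Mapping.single (Poly_Mapping.single v 1) 1"

abbreviation xS :: S where "xS \<equiv> Var VX"
abbreviation yS :: S where "yS \<equiv> Var VY"
abbreviation zS :: S where "zS \<equiv> Var VZ"

definition matrix_factorization :: "nat \<Rightarrow> S \<Rightarrow> S mat \<Rightarrow> S mat \<Rightarrow> bool" where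
  "matrix_factorization k f \<phi> \<psi> \<longleftrightarrow>
     \<phi> \<in> carrier_mat k k \<and> \<psi> \<in> carrier_mat k k \<and>
     \<phi> * \<psi> = f \<cdot>\<^sub>m 1\<^sub>m k \<and> \<psi> * \<phi> = f \<cdot>\<^sub>m 1\<^sub>m k"

text \<open>
  In the following definitions the subtractions are on natural numbers; they are only used for
  \<open>q < n\<close> and \<open>k < n\<close>, where they do not truncate.
\<close>

definition f_poly :: "nat \<Rightarrow> nat \<Rightarrow> S" where
  "f_poly n q = xS ^ (n - q) * yS - zS ^ n"

definition A_mat :: "nat \<Rightarrow> nat \<Rightarrow> nat \<Rightarrow> S mat" where
  "A_mat n q k = mat_of_rows_list 2
     [[yS, - (zS ^ k)],
      [- (zS ^ (n - k)), xS ^ (n - q)]]"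

definition B_mat :: "nat \<Rightarrow> nat \<Rightarrow> nat \<Rightarrow> S mat" where
  "B_mat n q k = mat_of_rows_list 2
     [[xS ^ (n - q), zS ^ k],
      [zS ^ (n - k), yS]]"

end

theory Submission imports Defs begin

text \<open>The matrix \<open>B_mat n q k\<close> is the adjugate of \<open>A_mat n q k\<close>,
  whose determinant is \<open>xS ^ (n - q) * yS - zS ^ k * zS ^ (n - k)\<close>, that is
  \<open>f_poly n q\<close>. A matrix over a commutative ring times its adjugate, in either order,
  is its determinant times the identity. For size 2 this is checked entrywise, using the two
  expansions below.\<close>

lemma mat_of_rows_list_2_times:
  fixes a b c d a' b' c' d' :: "'a :: semiring_1"
  shows "mat_of_rows_list 2 [[a, b], [c, d]] * mat_of_rows_list 2 [[a', b'], [c', d']] =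
    mat_of_rows_list 2 [[a * a' + b * c', a * b' + b * d'], [c * a' + d * c', c * b' + d * d']]"
  by (rule eq_matI)
    (auto simp: mat_of_rows_list_def scalar_prod_def less_Suc_eq numeral_2_eq_2)

text \<open>Brings the right-hand side into the same literal form as the product, so that comparing
  matrices becomes four identities in \<open>S\<close>.\<close>

lemma smult_one_mat_2:
  fixes f :: "'a :: semiring_1"
  shows "f \<cdot>\<^sub>m 1\<^sub>m 2 = mat_of_rows_list 2 [[f, 0], [0, f]]"
  by (rule eq_matI) (auto simp: mat_of_rows_list_def less_Suc_eq numeral_2_eq_2)

theorem proposition3p6:
  fixes n q :: nat
  assumes "coprime n q" and "0 < q" and "q < n" and "q \<noteq> n - 1"
  shows "\<forall>k::nat. 1 \<le> k \<and> k \<le> n - 1 \<longrightarrow>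
           matrix_factorization 2 (f_poly n q) (A_mat n q k) (B_mat n q k)"
proof (intro allI impI)
  fix k :: nat
  assume "1 \<le> k \<and> k \<le> n - 1"
  then have "k + (n - k) = n"
    by linarith
  \<comment> \<open>The two diagonal entries produce these factors in opposite orders.\<close>
  then have z: "zS ^ k * zS ^ (n - k) = zS ^ n" "zS ^ (n - k) * zS ^ k = zS ^ n"
    by (simp_all flip: power_add add: add.commute)
  have "A_mat n q k \<in> carrier_mat 2 2" "B_mat n q k \<in> carrier_mat 2 2"
    by (simp_all add: A_mat_def B_mat_def mat_of_rows_list_def numeral_2_eq_2)
  \<comment> \<open>Off the diagonal, the two terms cancel because \<open>S\<close> is commutative;
    on it, \<open>z\<close> merges the powers of \<open>zS\<close>.\<close>
  moreover have "A_mat n q k * B_mat n q k = f_poly n q \<cdot>\<^sub>m 1\<^sub>m 2"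
    unfolding A_mat_def B_mat_def f_poly_def mat_of_rows_list_2_times smult_one_mat_2
    by (simp add: z mult.commute)
  moreover have "B_mat n q k * A_mat n q k = f_poly n q \<cdot>\<^sub>m 1\<^sub>m 2"
    unfolding A_mat_def B_mat_def f_poly_def mat_of_rows_list_2_times smult_one_mat_2
    by (simp add: z mult.commute)
  ultimately show "matrix_factorization 2 (f_poly n q) (A_mat n q k) (B_mat n q k)"
    unfolding matrix_factorization_def by blast
qed

end
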